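(* Let $X$ be a real Banach space, let $\Phi_n : X \to \mathbb{R}$ ($n \in \mathbb{N}$) and $\Phi : X \to \mathbb{R}$ be functionals. Suppose that: (i) $\Phi$ and $\Phi_n$ are $C^1$-functionals for every $n\in\mathbb{N}$; (ii) if $(x_n)_{n\in\mathbb{N}} \subset X$ is such that $\sup_{n\in\mathbb{N}} |\Phi_n(x_n)| < \infty$ and $\lim_{n\to\infty} \|\partial \Phi_n(x_n)\| = 0$, then $(x_n)$ has a convergent subsequence; (iii) $\Phi_n \to \Phi$ uniformly on $X$ and $\partial\Phi_n \to \partial\Phi$ uniformly on $X$; (iv) $U\subset X$ is an open set and $\varepsilon, R>0$ are such that, for every $n\in\mathbb{N}$, $$-R < \inf_{x\in\overline{U}} \Phi_n(x) < \inf_{x\in\partial U}\Phi_n(x) - \varepsilon.$$ Then there exists a point $\bar{x}\in U$ such that $$\Phi(\bar{x}) = \inf_{x\in\overline{U}} \Phi(x) \quad\text{and}\quad \partial\Phi(\bar{x}) = 0.$$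
   Context: For a $C^1$-functional $\Psi: X\to\mathbb{R}$, $\partial\Psi(x) \in X^*$ denotes its (Fréchet) derivative at $x$, and $\|\partial\Psi(x)\|$ is the norm in the dual space $X^*$. For a set $U\subset X$, $\overline{U}$ is its closure and $\partial U$ its topological boundary. Uniform convergence $\Phi_n\to\Phi$ on $X$ means: for all $\varepsilon'>0$ there is $N\in\mathbb{N}$ such that $|\Phi(x)-\Phi_n(x)|<\varepsilon'$ for all $x\in X$ and $n\ge N$; uniform convergence of the derivatives is meant in the same way with the norm of $X^*$. *)

theory Defs
  imports "HOL-Analysis.Analysis"
begin

(* The Frechet derivative of a functional as an element of the dual space, modelled as
   'a \<Rightarrow>\<^sub>L real, whose norm is the operator norm.  Blinfun yields the intended
   functional only where the functional is differentiable. *)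
definition dual_deriv :: "('a::real_normed_vector \<Rightarrow> real) \<Rightarrow> 'a \<Rightarrow> ('a \<Rightarrow>\<^sub>L real)" where
  "dual_deriv \<Psi> x = Blinfun (frechet_derivative \<Psi> (at x))"

definition C1_functional :: "('a::real_normed_vector \<Rightarrow> real) \<Rightarrow> bool" where
  "C1_functional \<Psi> \<longleftrightarrow>
     (\<forall>x. \<Psi> differentiable (at x)) \<and> continuous_on UNIV (dual_deriv \<Psi>)"

lemma has_derivative_dual_deriv:
  assumes "\<Psi> differentiable (at x)"
  shows "(\<Psi> has_derivative blinfun_apply (dual_deriv \<Psi> x)) (at x)"
proof -
  have d: "(\<Psi> has_derivative frechet_derivative \<Psi> (at x)) (at x)"
    using assms frechet_derivative_works by blast
  then show ?thesis
    unfolding dual_deriv_def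
    by (simp add: bounded_linear_Blinfun_apply has_derivative_bounded_linear)
qed

lemma dual_deriv_eqI:
  assumes "(\<Psi> has_derivative blinfun_apply L) (at x)"
  shows "dual_deriv \<Psi> x = L"
  unfolding dual_deriv_def frechet_derivative_at[OF assms, symmetric]
  by (rule blinfun_apply_inverse)

end

theory Submission
  imports Defs
begin

text \<open>
  Write \<open>m\<close> for the infimum of \<open>\<Phi>\<close> over the closure of \<open>U\<close>. Uniform convergence carries the
  lower bound and the gap \<open>\<epsilon>\<close> between the infima over closure and frontier to \<open>\<Phi>\<close>
  (\<open>frontier_gap_uniform_limit\<close>), so Ekeland's principle can be applied to \<open>\<Phi>\<close> itself. It
  gives points \<open>x n\<close> of the closure with \<open>\<Phi> (x n)\<close> close to \<open>m\<close> at which \<open>\<Phi>\<close> has only a small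
  downward slope. The gap keeps these points off the frontier; at an interior point a small
  downward slope means a small derivative (\<open>almost_critical_near_infimum\<close>).

  The derivative of \<open>\<Phi>\<close> at \<open>x n\<close> thus tends to zero, and \<open>\<Phi> (x n)\<close> tends to \<open>m\<close>. By uniform
  convergence, the same is true of the derivative and the value of \<open>\<Phi>n n\<close> at \<open>x n\<close>. The
  compactness hypothesis then yields a limit point, which by continuity of \<open>\<Phi>\<close> and of its
  derivative is a critical point with value \<open>m\<close>; the gap keeps it inside \<open>U\<close>.
\<close>

text \<open>
  The relation ``\<open>y\<close> lies below \<open>x\<close> if \<open>f y + \<delta> * dist x y \<le> f x\<close>'' is transitive, and a
  descending sequence is Cauchy because its steps are paid for by the decrease of \<open>f\<close>. If every
  step nearly minimises \<open>f\<close> among the points still available, nothing else lies below the limit.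
\<close>

lemma ekeland_variational_principle:
  fixes f :: "'a::metric_space \<Rightarrow> real"
  assumes C: "complete C" and cont: "continuous_on C f" and bdd: "bdd_below (f ` C)"
    and \<delta>: "\<delta> > 0" and a: "a \<in> C"
  obtains x where "x \<in> C" "f x + \<delta> * dist a x \<le> f a"
    "\<And>y. y \<in> C \<Longrightarrow> y \<noteq> x \<Longrightarrow> f x < f y + \<delta> * dist x y"
proof -
  define S where "S x = {y \<in> C. f y + \<delta> * dist x y \<le> f x}" for x
  have S_trans: "z \<in> S x" if "y \<in> S x" "z \<in> S y" for x y z
  proof -
    have "\<delta> * dist x z \<le> \<delta> * (dist x y + dist y z)"
      using \<delta> by (intro mult_left_mono dist_triangle) auto
    then show ?thesis
      using that by (auto simp: S_def distrib_left)
  qed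
  have near_min: "\<exists>y\<in>S x. \<forall>z\<in>S x. f y \<le> f z + (1/2)^n" if "x \<in> C" for x and n :: nat
  proof -
    have ne: "f ` S x \<noteq> {}"
      using that by (auto simp: S_def)
    have bd: "bdd_below (f ` S x)"
      using bdd by (rule bdd_below_mono) (auto simp: S_def)
    have "Inf (f ` S x) < Inf (f ` S x) + (1/2)^n"
      by simp
    then obtain y where y: "y \<in> S x" "f y < Inf (f ` S x) + (1/2)^n"
      using cInf_lessD[OF ne] by blast
    have "f y \<le> f z + (1/2)^n" if "z \<in> S x" for z
      using cInf_lower[OF imageI[OF that] bd] y(2) by linarith
    then show ?thesis
      using y(1) by blast
  qed
  have "\<exists>u. \<forall>n. (u n \<in> C \<and> (n = 0 \<longrightarrow> u n = a)) \<and>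
      (u (Suc n) \<in> S (u n) \<and> (\<forall>z\<in>S (u n). f (u (Suc n)) \<le> f z + (1/2)^n))"
  proof (rule dependent_nat_choice)
    show "\<exists>x. x \<in> C \<and> ((0::nat) = 0 \<longrightarrow> x = a)"
      using a by blast
  next
    fix x and n :: nat
    assume "x \<in> C \<and> (n = 0 \<longrightarrow> x = a)"
    then obtain y where "y \<in> S x" "\<forall>z\<in>S x. f y \<le> f z + (1/2)^n"
      using near_min by blast
    then show "\<exists>y. (y \<in> C \<and> (Suc n = 0 \<longrightarrow> y = a)) \<and> y \<in> S x \<and> (\<forall>z\<in>S x. f y \<le> f z + (1/2)^n)"
      by (auto simp: S_def)
  qed
  then obtain u where u: "\<And>n. u n \<in> C" "u 0 = a" "\<And>n. u (Suc n) \<in> S (u n)"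
      "\<And>n z. z \<in> S (u n) \<Longrightarrow> f (u (Suc n)) \<le> f z + (1/2)^n"
    by blast
  have descend: "u n \<in> S (u k)" if "k \<le> n" for k n
    using that
  proof (induction n rule: dec_induct)
    case base
    show ?case
      using u(1) by (simp add: S_def)
  next
    case (step n)
    show ?case
      using S_trans[OF step.IH u(3)] .
  qed
  have "decseq (\<lambda>n. f (u n))"
  proof (rule decseq_SucI)
    fix n
    have "0 \<le> \<delta> * dist (u n) (u (Suc n))"
      using \<delta> by simp
    then show "f (u (Suc n)) \<le> f (u n)"
      using u(3)[of n] unfolding S_def by simp
  qed
  moreover obtain b where "\<And>n. b \<le> f (u n)"
    using bdd u(1) unfolding bdd_below_def by blast
  ultimately have "Cauchy (\<lambda>n. f (u n))"
    by (metis decseq_convergent LIMSEQ_imp_Cauchy)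
  have "Cauchy u"
  proof (rule metric_CauchyI)
    fix e :: real
    assume "e > 0"
    then have "\<delta> * e > 0"
      using \<delta> by simp
    then obtain N where N: "\<And>k n. k \<ge> N \<Longrightarrow> n \<ge> N \<Longrightarrow> dist (f (u k)) (f (u n)) < \<delta> * e"
      using \<open>Cauchy (\<lambda>n. f (u n))\<close> unfolding Cauchy_def by blast
    have close: "dist (u k) (u n) < e" if "k \<ge> N" "n \<ge> k" for k n
    proof -
      have "\<delta> * dist (u k) (u n) \<le> f (u k) - f (u n)"
        using descend[OF that(2)] by (simp add: S_def)
      also have "\<dots> < \<delta> * e"
        using N[of k n] that by (auto simp: dist_real_def)
      finally show ?thesis
        using \<delta> by simp
    qed
    have "dist (u k) (u n) < e" if "k \<ge> N" "n \<ge> N" for k n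
      using close[of k n] close[of n k] that by (cases "k \<le> n") (auto simp: dist_commute)
    then show "\<exists>N. \<forall>k\<ge>N. \<forall>n\<ge>N. dist (u k) (u n) < e"
      by blast
  qed
  then obtain x where x: "x \<in> C" "u \<longlonglongrightarrow> x"
    using C u(1) unfolding complete_def by blast
  have fx: "(\<lambda>n. f (u n)) \<longlonglongrightarrow> f x"
    using continuous_on_tendsto_compose[OF cont x(2) x(1)] u(1) by simp
  have x_below: "x \<in> S (u k)" for k
  proof -
    have "(\<lambda>n. f (u n) + \<delta> * dist (u k) (u n)) \<longlonglongrightarrow> f x + \<delta> * dist (u k) x"
      by (intro tendsto_intros fx x(2))
    then have "f x + \<delta> * dist (u k) x \<le> f (u k)"
      by (rule LIMSEQ_le_const2) (use descend in \<open>auto simp: S_def\<close>)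
    then show ?thesis
      using x(1) by (simp add: S_def)
  qed
  have "f x < f y + \<delta> * dist x y" if "y \<in> C" "y \<noteq> x" for y
  proof (rule ccontr)
    assume "\<not> f x < f y + \<delta> * dist x y"
    then have y: "y \<in> S x"
      using that(1) by (simp add: S_def)
    have "(\<lambda>n. f y + (1/2)^n) \<longlonglongrightarrow> f y + 0"
      by (intro tendsto_intros) simp_all
    moreover have "f (u (Suc n)) \<le> f y + (1/2)^n" for n
      using u(4) S_trans[OF x_below y] by blast
    ultimately have "f x \<le> f y"
      using LIMSEQ_le[OF LIMSEQ_Suc[OF fx]] by auto
    moreover have "\<delta> * dist x y > 0"
      using \<delta> that(2) by simp
    ultimately show False
      using y by (simp add: S_def)
  qed
  moreover have "f x + \<delta> * dist a x \<le> f a"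
    using x_below[of 0] u(2) by (simp add: S_def)
  ultimately show thesis
    using that x(1) by blast
qed

text \<open>
  A one-sided bound on the slope suffices, since the derivative in direction \<open>- v\<close> is minus the
  one in direction \<open>v\<close>.
\<close>

lemma norm_derivative_le_downward_slope:
  fixes f :: "'a::real_normed_vector \<Rightarrow> real"
  assumes deriv: "(f has_derivative blinfun_apply L) (at x)"
    and slope: "eventually (\<lambda>y. f x \<le> f y + \<delta> * dist x y) (nhds x)" and \<delta>: "\<delta> \<ge> 0"
  shows "norm L \<le> \<delta>"
proof (rule norm_blinfun_bound)
  have lower: "- (\<delta> * norm v) \<le> L v" for v
  proof -
    have line: "((\<lambda>t. x + t *\<^sub>R v) has_derivative (\<lambda>t. t *\<^sub>R v)) (at 0)"
      using has_derivative_add[OF has_derivative_const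
          has_derivative_scaleR_left[OF has_derivative_ident]] by simp
    have "((\<lambda>t. f (x + t *\<^sub>R v)) has_derivative (\<lambda>t. L (t *\<^sub>R v))) (at 0)"
      using has_derivative_compose[OF line, of f L] deriv by simp
    then have "((\<lambda>t. f (x + t *\<^sub>R v)) has_field_derivative L v) (at 0)"
      by (simp add: has_field_derivative_def blinfun.scaleR_right mult.commute[of _ "L v"])
    then have "((\<lambda>t. (f (x + t *\<^sub>R v) - f x) / t) \<longlongrightarrow> L v) (at 0)"
      by (simp add: DERIV_def)
    then have lim: "((\<lambda>t. (f (x + t *\<^sub>R v) - f x) / t) \<longlongrightarrow> L v) (at_right 0)"
      by (rule tendsto_mono[rotated]) (simp add: at_within_le_at)
    have "((\<lambda>t. x + t *\<^sub>R v) \<longlongrightarrow> x + 0 *\<^sub>R v) (at_right 0)"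
      by (intro tendsto_intros)
    then have "eventually (\<lambda>t. f x \<le> f (x + t *\<^sub>R v) + \<delta> * dist x (x + t *\<^sub>R v)) (at_right 0)"
      using slope by (auto simp: filterlim_iff)
    moreover have "eventually (\<lambda>t::real. t > 0) (at_right 0)"
      by (simp add: eventually_at_right_less)
    ultimately have "eventually (\<lambda>t. - (\<delta> * norm v) \<le> (f (x + t *\<^sub>R v) - f x) / t) (at_right 0)"
      by eventually_elim (simp add: field_simps dist_norm)
    then show ?thesis
      using tendsto_lowerbound[OF lim] by simp
  qed
  show "norm (L v) \<le> \<delta> * norm v" for v
    using lower[of v] lower[of "- v"] by (simp add: blinfun.minus_right)
qed (rule \<delta>)

text \<open>
  Ekeland's principle compares \<open>x\<close> only with points of \<open>closure U\<close>, which bounds a derivative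
  only at interior points. The condition \<open>\<delta> < \<epsilon>\<close> is what keeps \<open>x\<close> in the interior.
\<close>

lemma almost_critical_near_infimum:
  fixes f :: "'a::banach \<Rightarrow> real"
  assumes C1: "C1_functional f" and U: "open U" "U \<noteq> {}"
    and bdd: "bdd_below (f ` closure U)"
    and gap: "\<And>y. y \<in> frontier U \<Longrightarrow> (INF z\<in>closure U. f z) + \<epsilon> \<le> f y"
    and \<delta>: "0 < \<delta>" "\<delta> < \<epsilon>"
  obtains x where "x \<in> U" "f x \<le> (INF z\<in>closure U. f z) + \<delta>" "norm (dual_deriv f x) \<le> \<delta>"
proof -
  define m where "m = (INF z\<in>closure U. f z)"
  have "f ` closure U \<noteq> {}"
    using U(2) by auto
  moreover have "m < m + \<delta>"
    using \<delta>(1) by simp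
  ultimately obtain a where a: "a \<in> closure U" "f a < m + \<delta>"
    using cInf_lessD[of "f ` closure U" "m + \<delta>"] by (auto simp: m_def)
  have deriv: "(f has_derivative dual_deriv f x) (at x)" for x
    by (rule has_derivative_dual_deriv) (use C1 in \<open>simp add: C1_functional_def\<close>)
  have "continuous_on (closure U) f"
    by (rule has_derivative_continuous_on) (rule has_derivative_at_withinI[OF deriv])
  moreover have "complete (closure U)"
    by (simp add: complete_eq_closed)
  ultimately obtain x where x: "x \<in> closure U" "f x + \<delta> * dist a x \<le> f a"
      "\<And>y. y \<in> closure U \<Longrightarrow> y \<noteq> x \<Longrightarrow> f x < f y + \<delta> * dist x y"
    using ekeland_variational_principle[OF _ _ bdd \<delta>(1) a(1)] by blast
  have "0 \<le> \<delta> * dist a x"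
    using \<delta>(1) by simp
  then have fx: "f x < m + \<delta>"
    using x(2) a(2) by linarith
  have "x \<notin> frontier U"
    using gap[of x] fx \<delta>(2) by (auto simp: m_def)
  then have "x \<in> U"
    using x(1) U(1) by (auto simp: frontier_def interior_open)
  have "eventually (\<lambda>y. y \<in> U) (nhds x)"
    using U(1) \<open>x \<in> U\<close> by (rule eventually_nhds_in_open)
  then have "eventually (\<lambda>y. f x \<le> f y + \<delta> * dist x y) (nhds x)"
  proof eventually_elim
    case (elim y)
    then show ?case
      using x(3)[of y] closure_subset[of U] by (cases "y = x") force+
  qed
  then have "norm (dual_deriv f x) \<le> \<delta>"
    using norm_derivative_le_downward_slope[OF deriv] \<delta>(1) by simp
  then show thesis
    using that \<open>x \<in> U\<close> fx by (simp add: m_def)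
qed

text \<open>
  A point of the closure where \<open>fn n\<close> beats its value at \<open>y\<close> by \<open>\<epsilon>\<close> may vary with \<open>n\<close>, but passing
  from \<open>fn n\<close> to \<open>f\<close> costs at most twice the uniform distance of the two, wherever the point lies.
\<close>

lemma frontier_gap_uniform_limit:
  fixes f :: "'a::topological_space \<Rightarrow> real"
  assumes unif: "uniform_limit UNIV fn f sequentially"
    and lower: "\<And>n. - ereal R < (INF x\<in>closure U. ereal (fn n x))"
    and gap: "\<And>n. (INF x\<in>closure U. ereal (fn n x)) < (INF x\<in>frontier U. ereal (fn n x)) - ereal \<epsilon>"
  shows "U \<noteq> {}" "bdd_below (f ` closure U)"
    "\<And>y. y \<in> frontier U \<Longrightarrow> (INF x\<in>closure U. f x) + \<epsilon> \<le> f y"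
proof -
  show "U \<noteq> {}"
    using gap[of 0] by (auto simp: top_ereal_def)
  have "- R \<le> fn n x" if "x \<in> closure U" for n x
    using order.strict_trans2[OF lower[of n] INF_lower[OF that]] by simp
  then have "- R \<le> f x" if "x \<in> closure U" for x
    using LIMSEQ_le_const[OF tendsto_uniform_limitI[OF unif UNIV_I]] that by blast
  then show bdd: "bdd_below (f ` closure U)"
    by (rule bdd_belowI2)
  show "(INF x\<in>closure U. f x) + \<epsilon> \<le> f y" if y: "y \<in> frontier U" for y
  proof (rule field_le_epsilon)
    fix e :: real
    assume "e > 0"
    then have "eventually (\<lambda>n. \<forall>x\<in>UNIV. dist (fn n x) (f x) < e / 2) sequentially"
      using uniform_limitD[OF unif, of "e / 2"] by simp
    then obtain n where n: "\<And>x. \<bar>fn n x - f x\<bar> < e / 2"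
      by (auto simp: eventually_sequentially dist_real_def)
    have "(INF x\<in>frontier U. ereal (fn n x)) - ereal \<epsilon> \<le> ereal (fn n y) - ereal \<epsilon>"
      by (intro ereal_minus_mono INF_lower y order_refl)
    then have "(INF x\<in>closure U. ereal (fn n x)) < ereal (fn n y - \<epsilon>)"
      using gap[of n] by simp
    then obtain x where x: "x \<in> closure U" "fn n x < fn n y - \<epsilon>"
      by (auto simp: INF_less_iff)
    have "(INF x\<in>closure U. f x) \<le> f x"
      using bdd x(1) by (rule cINF_lower)
    then show "(INF x\<in>closure U. f x) + \<epsilon> \<le> f y + e"
      using n[of x] n[of y] x(2) by linarith
  qed
qed

lemma uniform_limit_along_sequence:
  fixes f :: "'a \<Rightarrow> 'b::real_normed_vector"
  assumes "uniform_limit UNIV fn f sequentially" and "(\<lambda>n. f (x n)) \<longlonglongrightarrow> l"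
  shows "(\<lambda>n. fn n (x n)) \<longlonglongrightarrow> l"
proof -
  have "(\<lambda>n. fn n (x n) - f (x n)) \<longlonglongrightarrow> 0"
  proof (rule tendstoI)
    fix e :: real
    assume "e > 0"
    from uniform_limitD[OF assms(1) this]
    show "eventually (\<lambda>n. dist (fn n (x n) - f (x n)) 0 < e) sequentially"
      by eventually_elim (simp add: dist_norm)
  qed
  from tendsto_add[OF this assms(2)] show ?thesis
    by simp
qed

theorem theorem4:
  fixes \<Phi>n :: "nat \<Rightarrow> 'a::banach \<Rightarrow> real"
    and \<Phi> :: "'a \<Rightarrow> real"
    and U :: "'a set"
    and \<epsilon> R :: real
  assumes C1: "C1_functional \<Phi>" "\<And>n. C1_functional (\<Phi>n n)"
    and compactness: "\<And>x :: nat \<Rightarrow> 'a.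
          (SUP n. ereal \<bar>\<Phi>n n (x n)\<bar>) < \<infinity> \<Longrightarrow>
          (\<lambda>n. norm (dual_deriv (\<Phi>n n) (x n))) \<longlonglongrightarrow> 0 \<Longrightarrow>
          \<exists>r :: nat \<Rightarrow> nat. strict_mono r \<and> convergent (x \<circ> r)"
    and unif: "uniform_limit UNIV \<Phi>n \<Phi> sequentially"
    and unif_deriv:
      "uniform_limit UNIV (\<lambda>n. dual_deriv (\<Phi>n n)) (dual_deriv \<Phi>) sequentially"
    and U: "open U"
    and pos: "\<epsilon> > 0" "R > 0"
    and lower: "\<And>n. - ereal R < (INF x\<in>closure U. ereal (\<Phi>n n x))"
    and gap: "\<And>n. (INF x\<in>closure U. ereal (\<Phi>n n x))
                   < (INF x\<in>frontier U. ereal (\<Phi>n n x)) - ereal \<epsilon>"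
  shows "\<exists>xb\<in>U. ereal (\<Phi> xb) = (INF x\<in>closure U. ereal (\<Phi> x)) \<and> dual_deriv \<Phi> xb = 0"
proof -
  define m where "m = (INF x\<in>closure U. \<Phi> x)"
  note limit_gap = frontier_gap_uniform_limit[OF unif lower gap]
  have m_le: "m \<le> \<Phi> x" if "x \<in> closure U" for x
    unfolding m_def using limit_gap(2) that by (rule cINF_lower)
  \<comment> \<open>The cap \<open>\<epsilon> / 2\<close> makes the gap exclude the frontier for every index, not just eventually,
     so that the points form a sequence in \<open>U\<close> indexed like the functionals.\<close>
  define \<delta> where "\<delta> n = min (\<epsilon> / 2) (inverse (real (Suc n)))" for n
  have \<delta>: "0 < \<delta> n" "\<delta> n < \<epsilon>" "\<delta> n \<le> inverse (real (Suc n))" for n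
    using pos(1) by (auto simp: \<delta>_def min_def)
  have "\<forall>n. \<exists>x. x \<in> U \<and> \<Phi> x \<le> m + \<delta> n \<and> norm (dual_deriv \<Phi> x) \<le> \<delta> n"
    using almost_critical_near_infimum[OF C1(1) U limit_gap \<delta>(1,2)] unfolding m_def by blast
  then obtain x where x: "\<And>n. x n \<in> U" "\<And>n. \<Phi> (x n) \<le> m + \<delta> n"
      "\<And>n. norm (dual_deriv \<Phi> (x n)) \<le> \<delta> n"
    by metis
  have "\<delta> \<longlonglongrightarrow> 0"
    using tendsto_sandwich[OF _ _ tendsto_const LIMSEQ_inverse_real_of_nat, of \<delta>] \<delta>
    by (simp add: less_imp_le)
  have x_closure: "x n \<in> closure U" for n
    using x(1) closure_subset by blast
  have value_lim: "(\<lambda>n. \<Phi> (x n)) \<longlonglongrightarrow> m"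
  proof (rule tendsto_sandwich[OF _ _ tendsto_const])
    show "(\<lambda>n. m + \<delta> n) \<longlonglongrightarrow> m"
      using tendsto_add[OF tendsto_const \<open>\<delta> \<longlonglongrightarrow> 0\<close>, of m] by simp
  qed (use m_le x_closure x(2) in auto)
  have deriv_lim: "(\<lambda>n. dual_deriv \<Phi> (x n)) \<longlonglongrightarrow> 0"
    by (rule Lim_null_comparison[OF _ \<open>\<delta> \<longlonglongrightarrow> 0\<close>]) (simp add: x(3))

  \<comment> \<open>The compactness hypothesis asks for a bound over all indices, including the finitely many
     at which \<open>\<Phi>n n\<close> may still be far from \<open>\<Phi>\<close>; convergence of the values provides it.\<close>
  have "Bseq (\<lambda>n. \<Phi>n n (x n))"
    using uniform_limit_along_sequence[OF unif value_lim] by (intro convergent_imp_Bseq convergentI)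
  then obtain B where "\<And>n. \<bar>\<Phi>n n (x n)\<bar> \<le> B"
    by (auto simp: Bseq_def)
  then have "(SUP n. ereal \<bar>\<Phi>n n (x n)\<bar>) \<le> ereal B"
    by (intro SUP_least) simp
  then have "(SUP n. ereal \<bar>\<Phi>n n (x n)\<bar>) < \<infinity>"
    by (rule le_less_trans) simp
  moreover have "(\<lambda>n. norm (dual_deriv (\<Phi>n n) (x n))) \<longlonglongrightarrow> 0"
    using uniform_limit_along_sequence[OF unif_deriv deriv_lim] by (rule tendsto_norm_zero)
  ultimately obtain r xb where r: "strict_mono r" and xb: "(x \<circ> r) \<longlonglongrightarrow> xb"
    using compactness[of x] by (auto simp: convergent_def)

  have "isCont \<Phi> xb"
    using C1(1) by (auto simp: C1_functional_def intro: differentiable_imp_continuous_within)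
  then have "(\<lambda>n. \<Phi> ((x \<circ> r) n)) \<longlonglongrightarrow> \<Phi> xb"
    using xb by (rule isCont_tendsto_compose)
  then have \<Phi>_xb: "\<Phi> xb = m"
    using LIMSEQ_unique LIMSEQ_subseq_LIMSEQ[OF value_lim r] by (auto simp: o_def)
  have "isCont (dual_deriv \<Phi>) xb"
    using C1(1) by (simp add: C1_functional_def continuous_on_eq_continuous_at)
  then have "(\<lambda>n. dual_deriv \<Phi> ((x \<circ> r) n)) \<longlonglongrightarrow> dual_deriv \<Phi> xb"
    using xb by (rule isCont_tendsto_compose)
  then have critical: "dual_deriv \<Phi> xb = 0"
    using LIMSEQ_unique LIMSEQ_subseq_LIMSEQ[OF deriv_lim r] by (auto simp: o_def)
  have "xb \<in> closure U"
    using closed_sequentially[OF closed_closure _ xb] x_closure by simp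
  moreover have "xb \<notin> frontier U"
    using limit_gap(3)[of xb] \<Phi>_xb pos(1) by (auto simp: m_def)
  ultimately have "xb \<in> U"
    using U by (auto simp: frontier_def interior_open)
  moreover have "ereal (\<Phi> xb) = (INF x\<in>closure U. ereal (\<Phi> x))"
  proof (rule antisym)
    show "ereal (\<Phi> xb) \<le> (INF x\<in>closure U. ereal (\<Phi> x))"
      using m_le \<Phi>_xb by (auto intro: INF_greatest)
    show "(INF x\<in>closure U. ereal (\<Phi> x)) \<le> ereal (\<Phi> xb)"
      using \<open>xb \<in> closure U\<close> by (rule INF_lower)
  qed
  ultimately show ?thesis
    using critical by blast
qed

end
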